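(* Suppose that $(\mathcal{N}_g,\mathcal{E}_g)$ is a connected graph and that there is a squared pressure value $\pi_c>0$ with $\pi_c\in[\underline{\pi}_i,\overline{\pi}_i]$ for all $i\in\mathcal{N}_g$. Then the feasible set $\mathcal{S}_{OGF}$ of the steady-state optimal gas flow problem (defined in the context) satisfies the globally star shaped (GSS) property: for every $\boldsymbol{x}$ in the projection of $\mathcal{S}_{OGF}$ onto the $\boldsymbol{x}$ variables and every $s\in[0,1]$, the vector $s\boldsymbol{x}$ also lies in this projection. Therefore, any locally optimal solution to the problem $$\min\ \sum_{i\in\mathcal{N}_g}c_iq_i+\sum_{(i,j)\in\mathcal{E}_g}c_{ij}(\alpha_{ij})\quad\text{s.t.}\quad(\boldsymbol{q},\boldsymbol{x})\in\mathcal{M}_{OGF},\quad(\boldsymbol{x},\boldsymbol{\pi},\boldsymbol{\phi},\boldsymbol{\alpha})\in\mathcal{S}_{OGF}$$ satisfying the Mangasarian-Fromovitz constraint qualification (in the form given in the context) is revenue adequate, i.e., $\mathcal{R}=-\lambda^T\boldsymbol{x}\ge0$, where $\lambda$ is the vector of dual variables of the constraints $x_i=q_i-d_i$, $i\in\mathcal{N}_g$.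
   Context: A gas pipeline network is represented by a finite set of junctions $\mathcal{N}_g$ connected by a set of oriented edges (pipes) $\mathcal{E}_g$; a subset $\mathcal{C}_g\subset\mathcal{E}_g$ of pipes have a compressor at the inlet. Given data: fixed outflows $d_i$, bounds $\underline{q}_i,\overline{q}_i$, $\underline{\pi}_i,\overline{\pi}_i$, $\underline{\pi}_{ij},\overline{\pi}_{ij}$, compression limits $\overline{\alpha}_{ij}>1$ for $(ij)\in\mathcal{C}_g$, pipe resistances $\beta_{ij}>0$, prices $c_i$, and compression price functions $c_{ij}$. Variables: optimized inflows $\boldsymbol{q}=(q_i)$, net inflows $\boldsymbol{x}=(x_i)$, squared pressures $\boldsymbol{\pi}$, consisting of the nodal values $\pi_i$ and the values $\pi_{ij}$, $\pi_{ji}$ at the start and end of each pipe $(i,j)\in\mathcal{E}_g$ (these are squares of pressures), pipe mass flows $\boldsymbol{\phi}=(\phi_{ij})_{(ij)\in\mathcal{E}_g}$ with the convention $\phi_{ji}=-\phi_{ij}$, and compression ratios $\boldsymbol{\alpha}=(\alpha_{ij})_{(ij)\in\mathcal{C}_g}$; for $(ij)\in\mathcal{E}_g\setminus\mathcal{C}_g$ one sets $\alpha_{ij}=\overline{\alpha}_{ij}=1$ (constants, not variables). $\partial i$ is the set of neighbors of $i$. $$\mathcal{M}_{OGF}=\{(\boldsymbol{q},\boldsymbol{x})\mid x_i=q_i-d_i,\ \underline{q}_i\le q_i\le\overline{q}_i\ \ \forall i\in\mathcal{N}_g\}.$$ $\mathcal{S}_{OGF}$ is the set of $(\boldsymbol{x},\boldsymbol{\pi},\boldsymbol{\phi},\boldsymbol{\alpha})$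 such that - $\sum_{j\in\partial i}\phi_{ij}=x_i$ for all $i\in\mathcal{N}_g$; - $\pi_{ij}-\pi_{ji}=\beta_{ij}\phi_{ij}|\phi_{ij}|$ for all $(ij)\in\mathcal{E}_g$; - $\pi_i\alpha_{ij}=\pi_{ij}$ and $\pi_j=\pi_{ji}$ for all $(ij)\in\mathcal{C}_g$; - $\pi_i=\pi_{ij}$ and $\pi_j=\pi_{ji}$ for all $(ij)\in\mathcal{E}_g\setminus\mathcal{C}_g$; - $\underline{\pi}_{ij}\le\pi_{ij}\le\overline{\pi}_{ij}$ for all $(ij)\in\mathcal{E}_g$; - $1\le\alpha_{ij}\le\overline{\alpha}_{ij}$ for all $(ij)\in\mathcal{E}_g$; - $\underline{\pi}_i\le\pi_i\le\overline{\pi}_i$ for all $i\in\mathcal{N}_g$. General form: put $q=\boldsymbol{q}$, $x=\boldsymbol{x}$, $y=(\boldsymbol{\pi},\boldsymbol{\phi},\boldsymbol{\alpha})$. The problem has constraints $\underline{q}\le q\le\overline{q}$, $x=q-d$, $H(x,y)=0$, $G(x,y)\le0$, where $H=(h_j)_{j=1}^{N_h}$ collects the equality constraints of $\mathcal{S}_{OGF}$ and $G=(g_i)_{i=1}^{N_g}$ its inequality constraints. The Lagrangian is the objective plus $\underline{\mu}^T(\underline{q}-q)+\overline{\mu}^T(q-\overline{q})+\lambda^T(x-q+d)+\nu_i^TG(x,y)+\nu_e^TH(x,y)$, with $\underline{\mu},\overline{\mu},\nu_i\ge0$; the dual variables at a local optimum are multipliers satisfying the KKT conditions (stationarity in $q,x,y$,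 dual feasibility and complementary slackness). Mangasarian-Fromovitz constraint qualification: the gradients of the equality constraints are linearly independent at $(q,x,y)$, and there exists a vector $\delta$ in the space of the $(x,y)$ variables such that $\nabla g_i(x,y)^T\delta<0$ for all inequality constraints $i=1,\dots,N_g$ and $\nabla h_j(x,y)^T\delta=0$ for all $j=1,\dots,N_h$. The net revenue is $\mathcal{R}=\lambda^T(d-q)=-\lambda^Tx$, and revenue adequacy means $\mathcal{R}\ge0$.
   Formalization: π_c must also lie in every pipe's bounds (otherwise GSS can fail); node bounds are ≥0. The stated MFCQ is never satisfiable, so revenue adequacy is also proved for MFCQ on binding constraints, assuming nondecreasing c_ij and positive lower nodal bounds. *)

theory Defs
  imports "HOL-Analysis.Analysis"
begin

text \<open>
  The junctions are all elements of the finite type \<open>'n\<close>; a pipe \<open>(ij)\<close> is the pair \<open>(i, j)\<close>.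
  The fields \<open>pipe_lo\<close>, \<open>pipe_hi\<close>, \<open>resistance\<close> and \<open>comp_price\<close> are only meaningful on \<open>pipes\<close>.
\<close>

record ('n::finite) gas_network =
  pipes :: "('n \<times> 'n) set"
  compressors :: "('n \<times> 'n) set"
  outflow :: "real ^ 'n"
  q_lo :: "real ^ 'n"
  q_hi :: "real ^ 'n"
  node_lo :: "real ^ 'n"
  node_hi :: "real ^ 'n"
  pipe_lo :: "'n \<Rightarrow> 'n \<Rightarrow> real"
  pipe_hi :: "'n \<Rightarrow> 'n \<Rightarrow> real"
  ratio_hi :: "'n \<Rightarrow> 'n \<Rightarrow> real"
  resistance :: "'n \<Rightarrow> 'n \<Rightarrow> real"
  price :: "real ^ 'n"
  comp_price :: "'n \<Rightarrow> 'n \<Rightarrow> real \<Rightarrow> real"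

text \<open>
  A pair of junctions is joined by at most one pipe, with one orientation; otherwise
  \<open>\<phi>\<^sub>j\<^sub>i = - \<phi>\<^sub>i\<^sub>j\<close> could not be a convention.  The node bounds limit squares of pressures, so they
  are nonnegative.
\<close>

definition valid_network :: "('n::finite) gas_network \<Rightarrow> bool" where
  "valid_network G \<longleftrightarrow>
     (\<forall>i j. (i, j) \<in> pipes G \<longrightarrow> (j, i) \<notin> pipes G) \<and>
     compressors G \<subseteq> pipes G \<and>
     (\<forall>(i, j) \<in> compressors G. 1 < ratio_hi G i j) \<and>
     (\<forall>(i, j) \<in> pipes G - compressors G. ratio_hi G i j = 1) \<and>
     (\<forall>(i, j) \<in> pipes G. 0 < resistance G i j) \<and>
     (\<forall>i. 0 \<le> node_lo G $ i)"

definition connected_network :: "('n::finite) gas_network \<Rightarrow> bool" where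
  "connected_network G \<longleftrightarrow> (\<forall>i j. (i, j) \<in> (pipes G \<union> (pipes G)\<inverse>)\<^sup>*)"

definition neighbours :: "('n::finite) gas_network \<Rightarrow> 'n \<Rightarrow> 'n set" where
  "neighbours G i = {j. (i, j) \<in> pipes G \<or> (j, i) \<in> pipes G}"

text \<open>
  The variables \<open>y = (\<pi>, \<phi>, \<alpha>)\<close> are stored as \<open>(pn, pp, \<phi>, \<alpha>)\<close>: nodal squared pressures
  \<open>pn $ i\<close>, squared pressures \<open>pp $ i $ j\<close> and \<open>pp $ j $ i\<close> at the start and at the end of the
  pipe \<open>(i, j)\<close>, flows \<open>\<phi> $ i $ j\<close> for \<open>(i, j) \<in> pipes G\<close>, and ratios \<open>\<alpha> $ i $ j\<close> for
  \<open>(i, j) \<in> compressors G\<close>.  Nothing below depends on the remaining entries of these arrays, so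
  they do not affect feasibility, local optimality, or the vanishing or independence of gradients.
\<close>

type_synonym 'n pvars = "(real ^ 'n) \<times> (real ^ 'n ^ 'n) \<times> (real ^ 'n ^ 'n) \<times> (real ^ 'n ^ 'n)"
type_synonym 'n xyvars = "(real ^ 'n) \<times> 'n pvars"
type_synonym 'n qxyvars = "(real ^ 'n) \<times> 'n xyvars"

definition flow :: "('n::finite) gas_network \<Rightarrow> real ^ 'n ^ 'n \<Rightarrow> 'n \<Rightarrow> 'n \<Rightarrow> real" where
  "flow G \<phi> i j = (if (i, j) \<in> pipes G then \<phi> $ i $ j else - (\<phi> $ j $ i))"

definition ratio :: "('n::finite) gas_network \<Rightarrow> real ^ 'n ^ 'n \<Rightarrow> 'n \<Rightarrow> 'n \<Rightarrow> real" where
  "ratio G \<alpha> i j = (if (i, j) \<in> compressors G then \<alpha> $ i $ j else 1)"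

definition M_OGF :: "('n::finite) gas_network \<Rightarrow> ((real ^ 'n) \<times> (real ^ 'n)) set" where
  "M_OGF G = {(q, x). \<forall>i. x $ i = q $ i - outflow G $ i \<and>
                          q_lo G $ i \<le> q $ i \<and> q $ i \<le> q_hi G $ i}"

definition S_OGF :: "('n::finite) gas_network \<Rightarrow> 'n xyvars set" where
  "S_OGF G = {(x, pn, pp, \<phi>, \<alpha>).
     (\<forall>i. (\<Sum>j\<in>neighbours G i. flow G \<phi> i j) = x $ i) \<and>
     (\<forall>(i, j) \<in> pipes G.
        pp $ i $ j - pp $ j $ i = resistance G i j * flow G \<phi> i j * \<bar>flow G \<phi> i j\<bar>) \<and>
     (\<forall>(i, j) \<in> compressors G. pn $ i * ratio G \<alpha> i j = pp $ i $ j \<and> pn $ j = pp $ j $ i) \<and>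
     (\<forall>(i, j) \<in> pipes G - compressors G. pn $ i = pp $ i $ j \<and> pn $ j = pp $ j $ i) \<and>
     (\<forall>(i, j) \<in> pipes G. pipe_lo G i j \<le> pp $ i $ j \<and> pp $ i $ j \<le> pipe_hi G i j) \<and>
     (\<forall>(i, j) \<in> pipes G. 1 \<le> ratio G \<alpha> i j \<and> ratio G \<alpha> i j \<le> ratio_hi G i j) \<and>
     (\<forall>i. node_lo G $ i \<le> pn $ i \<and> pn $ i \<le> node_hi G $ i)}"

definition globally_star_shaped :: "('n::finite) xyvars set \<Rightarrow> bool" where
  "globally_star_shaped S \<longleftrightarrow> (\<forall>x \<in> fst ` S. \<forall>s \<in> {0..1}. s *\<^sub>R x \<in> fst ` S)"

definition objective :: "('n::finite) gas_network \<Rightarrow> 'n qxyvars \<Rightarrow> real" where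
  "objective G = (\<lambda>(q, x, pn, pp, \<phi>, \<alpha>).
     (\<Sum>i\<in>UNIV. price G $ i * q $ i) +
     (\<Sum>(i, j)\<in>pipes G. comp_price G i j (ratio G \<alpha> i j)))"

definition feasible_set :: "('n::finite) gas_network \<Rightarrow> 'n qxyvars set" where
  "feasible_set G = {(q, x, y). (q, x) \<in> M_OGF G \<and> (x, y) \<in> S_OGF G}"

definition locally_optimal :: "('n::finite) gas_network \<Rightarrow> 'n qxyvars \<Rightarrow> bool" where
  "locally_optimal G z \<longleftrightarrow> z \<in> feasible_set G \<and>
     (\<exists>\<epsilon>>0. \<forall>z'\<in>feasible_set G. dist z' z < \<epsilon> \<longrightarrow> objective G z \<le> objective G z')"

text \<open>
  The constraints \<open>H(x, y) = 0\<close> and \<open>G(x, y) \<le> 0\<close> that make up \<open>S_OGF\<close>.  Off the compressors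
  \<open>1 \<le> ratio G \<alpha> i j \<le> ratio_hi G i j\<close> reads \<open>1 \<le> 1 \<le> 1\<close>; it restricts no variable and is not
  a component of \<open>G\<close>.
\<close>

datatype 'n eq_constr = Balance 'n | Pressure_Drop 'n 'n | Inlet 'n 'n | Outlet 'n 'n

datatype 'n ineq_constr =
    Pipe_Lower 'n 'n | Pipe_Upper 'n 'n | Ratio_Lower 'n 'n | Ratio_Upper 'n 'n
  | Node_Lower 'n | Node_Upper 'n

definition eq_constrs :: "('n::finite) gas_network \<Rightarrow> 'n eq_constr set" where
  "eq_constrs G = range Balance \<union>
     (\<Union>(i, j)\<in>pipes G. {Pressure_Drop i j, Inlet i j, Outlet i j})"

definition ineq_constrs :: "('n::finite) gas_network \<Rightarrow> 'n ineq_constr set" where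
  "ineq_constrs G =
     (\<Union>(i, j)\<in>pipes G. {Pipe_Lower i j, Pipe_Upper i j}) \<union>
     (\<Union>(i, j)\<in>compressors G. {Ratio_Lower i j, Ratio_Upper i j}) \<union>
     range Node_Lower \<union> range Node_Upper"

fun eq_fun :: "('n::finite) gas_network \<Rightarrow> 'n eq_constr \<Rightarrow> 'n xyvars \<Rightarrow> real" where
  "eq_fun G (Balance i) (x, pn, pp, \<phi>, \<alpha>) = (\<Sum>j\<in>neighbours G i. flow G \<phi> i j) - x $ i"
| "eq_fun G (Pressure_Drop i j) (x, pn, pp, \<phi>, \<alpha>) =
     pp $ i $ j - pp $ j $ i - resistance G i j * flow G \<phi> i j * \<bar>flow G \<phi> i j\<bar>"
| "eq_fun G (Inlet i j) (x, pn, pp, \<phi>, \<alpha>) = pn $ i * ratio G \<alpha> i j - pp $ i $ j"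
| "eq_fun G (Outlet i j) (x, pn, pp, \<phi>, \<alpha>) = pn $ j - pp $ j $ i"

fun ineq_fun :: "('n::finite) gas_network \<Rightarrow> 'n ineq_constr \<Rightarrow> 'n xyvars \<Rightarrow> real" where
  "ineq_fun G (Pipe_Lower i j) (x, pn, pp, \<phi>, \<alpha>) = pipe_lo G i j - pp $ i $ j"
| "ineq_fun G (Pipe_Upper i j) (x, pn, pp, \<phi>, \<alpha>) = pp $ i $ j - pipe_hi G i j"
| "ineq_fun G (Ratio_Lower i j) (x, pn, pp, \<phi>, \<alpha>) = 1 - ratio G \<alpha> i j"
| "ineq_fun G (Ratio_Upper i j) (x, pn, pp, \<phi>, \<alpha>) = ratio G \<alpha> i j - ratio_hi G i j"
| "ineq_fun G (Node_Lower i) (x, pn, pp, \<phi>, \<alpha>) = node_lo G $ i - pn $ i"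
| "ineq_fun G (Node_Upper i) (x, pn, pp, \<phi>, \<alpha>) = pn $ i - node_hi G $ i"

lemma S_OGF_iff_constraints:
  assumes "valid_network G"
  shows "xy \<in> S_OGF G \<longleftrightarrow>
    (\<forall>k\<in>eq_constrs G. eq_fun G k xy = 0) \<and> (\<forall>k\<in>ineq_constrs G. ineq_fun G k xy \<le> 0)"
proof -
  obtain x pn pp \<phi> \<alpha> where xy: "xy = (x, pn, pp, \<phi>, \<alpha>)" by (metis surj_pair)
  have C: "compressors G \<subseteq> pipes G"
    and r: "\<forall>(i, j) \<in> pipes G - compressors G. ratio_hi G i j = 1"
    using assms by (auto simp: valid_network_def)
  have eq: "(\<forall>k\<in>eq_constrs G. eq_fun G k xy = 0) \<longleftrightarrow>
     (\<forall>i. (\<Sum>j\<in>neighbours G i. flow G \<phi> i j) = x $ i) \<and>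
     (\<forall>(i, j) \<in> pipes G.
        pp $ i $ j - pp $ j $ i = resistance G i j * flow G \<phi> i j * \<bar>flow G \<phi> i j\<bar>) \<and>
     (\<forall>(i, j) \<in> compressors G. pn $ i * ratio G \<alpha> i j = pp $ i $ j \<and> pn $ j = pp $ j $ i) \<and>
     (\<forall>(i, j) \<in> pipes G - compressors G. pn $ i = pp $ i $ j \<and> pn $ j = pp $ j $ i)"
    unfolding xy eq_constrs_def using C
    by (simp add: ball_Un split_beta ratio_def) (blast | fastforce)+
  have ineq: "(\<forall>k\<in>ineq_constrs G. ineq_fun G k xy \<le> 0) \<longleftrightarrow>
     (\<forall>(i, j) \<in> pipes G. pipe_lo G i j \<le> pp $ i $ j \<and> pp $ i $ j \<le> pipe_hi G i j) \<and>
     (\<forall>(i, j) \<in> pipes G. 1 \<le> ratio G \<alpha> i j \<and> ratio G \<alpha> i j \<le> ratio_hi G i j) \<and>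
     (\<forall>i. node_lo G $ i \<le> pn $ i \<and> pn $ i \<le> node_hi G $ i)"
    unfolding xy ineq_constrs_def using C r
    by (simp add: ball_Un split_beta ratio_def) (blast | fastforce)+
  show ?thesis
    unfolding eq ineq by (simp add: xy S_OGF_def)
qed

definition lagrangian :: "('n::finite) gas_network \<Rightarrow> real ^ 'n \<Rightarrow> real ^ 'n \<Rightarrow> real ^ 'n \<Rightarrow>
    ('n ineq_constr \<Rightarrow> real) \<Rightarrow> ('n eq_constr \<Rightarrow> real) \<Rightarrow> 'n qxyvars \<Rightarrow> real" where
  "lagrangian G \<mu>l \<mu>u lam \<nu>i \<nu>e = (\<lambda>(q, x, y).
     objective G (q, x, y) + \<mu>l \<bullet> (q_lo G - q) + \<mu>u \<bullet> (q - q_hi G) + lam \<bullet> (x - q + outflow G) +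
     (\<Sum>k\<in>ineq_constrs G. \<nu>i k * ineq_fun G k (x, y)) +
     (\<Sum>k\<in>eq_constrs G. \<nu>e k * eq_fun G k (x, y)))"

definition kkt_multipliers :: "('n::finite) gas_network \<Rightarrow> 'n qxyvars \<Rightarrow>
    real ^ 'n \<Rightarrow> real ^ 'n \<Rightarrow> real ^ 'n \<Rightarrow>
    ('n ineq_constr \<Rightarrow> real) \<Rightarrow> ('n eq_constr \<Rightarrow> real) \<Rightarrow> bool" where
  "kkt_multipliers G z \<mu>l \<mu>u lam \<nu>i \<nu>e \<longleftrightarrow> (case z of (q, x, y) \<Rightarrow>
     (GDERIV (lagrangian G \<mu>l \<mu>u lam \<nu>i \<nu>e) (q, x, y) :> 0) \<and>
     (\<forall>i. 0 \<le> \<mu>l $ i \<and> 0 \<le> \<mu>u $ i) \<and> (\<forall>k\<in>ineq_constrs G. 0 \<le> \<nu>i k) \<and>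
     (\<forall>i. \<mu>l $ i * (q_lo G $ i - q $ i) = 0 \<and> \<mu>u $ i * (q $ i - q_hi G $ i) = 0) \<and>
     (\<forall>k\<in>ineq_constrs G. \<nu>i k * ineq_fun G k (x, y) = 0))"

text \<open>All functions whose gradient is taken below are differentiable.\<close>

definition gradient :: "('a::real_inner \<Rightarrow> real) \<Rightarrow> 'a \<Rightarrow> 'a" where
  "gradient f z = (THE D. GDERIV f z :> D)"

definition mfcq_wrt :: "('n::finite) ineq_constr set \<Rightarrow> 'n gas_network \<Rightarrow> 'n qxyvars \<Rightarrow> bool" where
  "mfcq_wrt K G z \<longleftrightarrow> (case z of (q, xy) \<Rightarrow>
     (\<forall>u. (\<Sum>k\<in>eq_constrs G. u k *\<^sub>R gradient (eq_fun G k) xy) = 0 \<longrightarrow>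
          (\<forall>k\<in>eq_constrs G. u k = 0)) \<and>
     (\<exists>\<delta>. (\<forall>k\<in>K. gradient (ineq_fun G k) xy \<bullet> \<delta> < 0) \<and>
          (\<forall>k\<in>eq_constrs G. gradient (eq_fun G k) xy \<bullet> \<delta> = 0)))"

text \<open>
  \<open>mfcq\<close> asks for a strict decrease of every component of \<open>G\<close>, binding or not.  The lower and the
  upper bound on the same \<open>\<pi>\<^sub>i\<close> have opposite gradients, so no point satisfies it.
  \<open>mfcq_active\<close> is the usual condition, on the binding components only.
\<close>

definition mfcq :: "('n::finite) gas_network \<Rightarrow> 'n qxyvars \<Rightarrow> bool" where
  "mfcq G z \<longleftrightarrow> mfcq_wrt (ineq_constrs G) G z"

definition mfcq_active :: "('n::finite) gas_network \<Rightarrow> 'n qxyvars \<Rightarrow> bool" where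
  "mfcq_active G z \<longleftrightarrow> mfcq_wrt {k \<in> ineq_constrs G. ineq_fun G k (snd z) = 0} G z"

definition net_revenue :: "('n::finite) gas_network \<Rightarrow> real ^ 'n \<Rightarrow> 'n qxyvars \<Rightarrow> real" where
  "net_revenue G lam z = lam \<bullet> (outflow G - fst z)"

lemma net_revenue_eq:
  assumes "(q, x, y) \<in> feasible_set G"
  shows "net_revenue G lam (q, x, y) = - (lam \<bullet> x)"
proof -
  have "x = q - outflow G"
    using assms by (simp add: feasible_set_def M_OGF_def vec_eq_iff)
  then show ?thesis
    by (simp add: net_revenue_def inner_diff_right)
qed

definition revenue_adequate :: "('n::finite) gas_network \<Rightarrow> 'n qxyvars \<Rightarrow> bool" where
  "revenue_adequate G z \<longleftrightarrow>
     (\<forall>\<mu>l \<mu>u lam \<nu>i \<nu>e. kkt_multipliers G z \<mu>l \<mu>u lam \<nu>i \<nu>e \<longrightarrow> 0 \<le> net_revenue G lam z)"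

end

theory Submission
  imports Defs
begin

text \<open>
  Scaling the flows by \<open>s\<close> scales the pressure drops by \<open>s\<^sup>2\<close>, so a feasible point is joined to the
  state with zero flows and constant squared pressure \<open>\<pi>\<^sub>c\<close> by
  \<open>s \<mapsto> (s x, s\<^sup>2 \<pi> + (1 - s\<^sup>2) \<pi>\<^sub>c, s \<phi>, \<alpha>(s))\<close>, where \<open>\<alpha>(s)\<close> is the quotient of the new pressures at
  the two sides of a compressor and lies between 1 and \<open>\<alpha>\<close>.  This gives the star shape.

  Along this path the equality constraints vanish, the terms \<open>\<nu>\<^sub>i G\<close> are at most their value 0 at
  \<open>s = 1\<close>, and the compression cost does not exceed its value at \<open>s = 1\<close>; hence the Lagrangian
  drops by at least \<open>(1 - s) \<lambda> \<bullet> x\<close>.  As it is stationary at \<open>s = 1\<close>, \<open>\<lambda> \<bullet> x \<le> 0\<close>.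
\<close>

section \<open>The scaled path and its feasibility\<close>

definition mixed_ratio :: "real \<Rightarrow> real \<Rightarrow> real \<Rightarrow> real \<Rightarrow> real" where
  "mixed_ratio c s p a = (s\<^sup>2 * (p * a) + (1 - s\<^sup>2) * c) / (s\<^sup>2 * p + (1 - s\<^sup>2) * c)"

fun scaled_state :: "real \<Rightarrow> real \<Rightarrow> ('n::finite) xyvars \<Rightarrow> 'n xyvars" where
  "scaled_state c s (x, pn, pp, \<phi>, \<alpha>) =
     (s *\<^sub>R x, \<chi> i. s\<^sup>2 * pn $ i + (1 - s\<^sup>2) * c, \<chi> i j. s\<^sup>2 * pp $ i $ j + (1 - s\<^sup>2) * c,
      s *\<^sub>R \<phi>, \<chi> i j. mixed_ratio c s (pn $ i) (\<alpha> $ i $ j))"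

text \<open>The quotient is the weighted mean of \<open>a\<close> and 1 with weights
  \<open>s\<^sup>2 * p\<close> and \<open>(1 - s\<^sup>2) * c\<close>; \<open>pos\<close> says that
  the total weight is positive.\<close>

lemma mixed_ratio_bounds:
  assumes "0 \<le> p" "0 < c" "0 \<le> s" "s \<le> 1" "1 \<le> a" and pos: "0 < s\<^sup>2 * p + (1 - s\<^sup>2) * c"
  shows "1 \<le> mixed_ratio c s p a" "mixed_ratio c s p a \<le> a"
proof -
  have s2: "s\<^sup>2 \<le> 1"
    using assms by (simp add: power_le_one)
  have "s\<^sup>2 * p \<le> s\<^sup>2 * (p * a)"
    using assms by (intro mult_left_mono) (simp_all add: mult_le_cancel_left1)
  then show "1 \<le> mixed_ratio c s p a"
    using pos by (simp add: mixed_ratio_def)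
  have "(1 - s\<^sup>2) * c * 1 \<le> (1 - s\<^sup>2) * c * a"
    using assms s2 by (intro mult_left_mono) simp_all
  then show "mixed_ratio c s p a \<le> a"
    using pos by (simp add: mixed_ratio_def divide_simps algebra_simps)
qed

lemma convex_comb_between:
  fixes l u p c t :: real
  assumes "l \<le> p" "p \<le> u" "l \<le> c" "c \<le> u" "0 \<le> t" "t \<le> 1"
  shows "l \<le> t * p + (1 - t) * c" "t * p + (1 - t) * c \<le> u"
proof -
  have "t * l + (1 - t) * l \<le> t * p + (1 - t) * c" "t * p + (1 - t) * c \<le> t * u + (1 - t) * u"
    using assms by (intro add_mono mult_left_mono; simp)+
  then show "l \<le> t * p + (1 - t) * c" "t * p + (1 - t) * c \<le> u"
    by (simp_all add: algebra_simps)
qed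

lemma flow_scaleR: "flow G (s *\<^sub>R \<phi>) i j = s * flow G \<phi> i j"
  by (simp add: flow_def)

text \<open>Balance is linear in (x, \<phi>). The pressure drop is homogeneous of degree two in
  \<phi> for s >= 0, and the offset (1 - s^2) c cancels in pressure differences. Box constraints on
  pressures hold for \<open>c\<close> and for the given state, hence for their convex combination.
  The compressor equation fixes the new ratio, with \<open>pos\<close> allowing the
  division.\<close>

lemma scaled_state_feasible:
  assumes valid: "valid_network G" and "0 < c"
    and node: "\<forall>i. node_lo G $ i \<le> c \<and> c \<le> node_hi G $ i"
    and pipe: "\<forall>(i, j) \<in> pipes G. pipe_lo G i j \<le> c \<and> c \<le> pipe_hi G i j"
    and S: "(x, pn, pp, \<phi>, \<alpha>) \<in> S_OGF G"
    and s: "0 \<le> s" "s \<le> 1"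
    and pos: "\<forall>i. 0 < s\<^sup>2 * pn $ i + (1 - s\<^sup>2) * c"
  shows "scaled_state c s (x, pn, pp, \<phi>, \<alpha>) \<in> S_OGF G"
proof -
  let ?a = "\<chi> i j. mixed_ratio c s (pn $ i) (\<alpha> $ i $ j)"
  have s2: "0 \<le> s\<^sup>2" "s\<^sup>2 \<le> 1"
    using s by (simp_all add: power_le_one)
  have lo: "\<And>i. 0 \<le> node_lo G $ i"
    using valid by (auto simp: valid_network_def)
  have bal: "\<And>i. (\<Sum>j\<in>neighbours G i. flow G \<phi> i j) = x $ i"
    and drop: "\<And>i j. (i, j) \<in> pipes G \<Longrightarrow>
      pp $ i $ j - pp $ j $ i = resistance G i j * flow G \<phi> i j * \<bar>flow G \<phi> i j\<bar>"
    and comp: "\<And>i j. (i, j) \<in> compressors G \<Longrightarrow> pn $ i * ratio G \<alpha> i j = pp $ i $ j \<and> pn $ j = pp $ j $ i"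
    and nocomp: "\<And>i j. (i, j) \<in> pipes G - compressors G \<Longrightarrow> pn $ i = pp $ i $ j \<and> pn $ j = pp $ j $ i"
    and pb: "\<And>i j. (i, j) \<in> pipes G \<Longrightarrow> pipe_lo G i j \<le> pp $ i $ j \<and> pp $ i $ j \<le> pipe_hi G i j"
    and rb: "\<And>i j. (i, j) \<in> pipes G \<Longrightarrow> 1 \<le> ratio G \<alpha> i j \<and> ratio G \<alpha> i j \<le> ratio_hi G i j"
    and nb: "\<And>i. node_lo G $ i \<le> pn $ i \<and> pn $ i \<le> node_hi G $ i"
    using S by (auto simp: S_OGF_def)
  have pn0: "0 \<le> pn $ i" for i
    using lo nb order_trans by blast
  have drop': "s\<^sup>2 * pp $ i $ j - s\<^sup>2 * pp $ j $ i = resistance G i j * (s * flow G \<phi> i j) * \<bar>s * flow G \<phi> i j\<bar>"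
    if "(i, j) \<in> pipes G" for i j
    using drop[OF that] s by (simp add: abs_mult power2_eq_square flip: right_diff_distrib)
  have comp': "(s\<^sup>2 * pn $ i + (1 - s\<^sup>2) * c) * ratio G ?a i j = s\<^sup>2 * pp $ i $ j + (1 - s\<^sup>2) * c"
    if "(i, j) \<in> compressors G" for i j
    using comp[OF that] pos[rule_format, of i] that by (simp add: ratio_def mixed_ratio_def)
  have rb': "1 \<le> ratio G ?a i j \<and> ratio G ?a i j \<le> ratio_hi G i j" if "(i, j) \<in> pipes G" for i j
  proof (cases "(i, j) \<in> compressors G")
    case True
    then have "1 \<le> \<alpha> $ i $ j" "\<alpha> $ i $ j \<le> ratio_hi G i j"
      using rb[OF that] by (simp_all add: ratio_def)
    with mixed_ratio_bounds[OF pn0 \<open>0 < c\<close> s, of "\<alpha> $ i $ j" i] pos True show ?thesis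
      by (simp add: ratio_def order_trans)
  next
    case False
    then show ?thesis
      using rb[OF that] by (simp add: ratio_def)
  qed
  have nb': "node_lo G $ i \<le> s\<^sup>2 * pn $ i + (1 - s\<^sup>2) * c \<and> s\<^sup>2 * pn $ i + (1 - s\<^sup>2) * c \<le> node_hi G $ i"
    for i
    using convex_comb_between[of "node_lo G $ i" "pn $ i" "node_hi G $ i" c "s\<^sup>2"] nb node s2 by blast
  have pb': "pipe_lo G i j \<le> s\<^sup>2 * pp $ i $ j + (1 - s\<^sup>2) * c \<and>
      s\<^sup>2 * pp $ i $ j + (1 - s\<^sup>2) * c \<le> pipe_hi G i j" if "(i, j) \<in> pipes G" for i j
    using convex_comb_between[of "pipe_lo G i j" "pp $ i $ j" "pipe_hi G i j" c "s\<^sup>2"]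
      pb[OF that] pipe that s2 by blast
  have bal': "(\<Sum>j\<in>neighbours G i. s * flow G \<phi> i j) = s * x $ i" for i
    by (simp add: bal flip: sum_distrib_left)
  have "\<forall>(i, j) \<in> compressors G. pn $ j = pp $ j $ i"
    and "\<forall>(i, j) \<in> pipes G - compressors G. pn $ i = pp $ i $ j \<and> pn $ j = pp $ j $ i"
    using comp nocomp by blast+
  then show ?thesis
    unfolding scaled_state.simps S_OGF_def mem_Collect_eq prod.case flow_scaleR
    using bal' drop' comp' rb' pb' nb' by (simp add: split_beta)
qed

lemma globally_star_shaped_S_OGF:
  assumes "valid_network G" "0 < c"
    and "\<forall>i. node_lo G $ i \<le> c \<and> c \<le> node_hi G $ i"
    and "\<forall>(i, j) \<in> pipes G. pipe_lo G i j \<le> c \<and> c \<le> pipe_hi G i j"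
  shows "globally_star_shaped (S_OGF G)"
  unfolding globally_star_shaped_def
proof (intro ballI)
  fix x and s :: real
  assume "x \<in> fst ` S_OGF G" and s: "s \<in> {0..1}"
  then obtain pn pp \<phi> \<alpha> where S: "(x, pn, pp, \<phi>, \<alpha>) \<in> S_OGF G"
    by auto
  show "s *\<^sub>R x \<in> fst ` S_OGF G"
  \<comment> \<open>If a nodal pressure is 0, the ratio at s = 1 would be 0 / 0 = 0, which is below
    1, so this endpoint is handled apart. For s < 1 the term (1 - s^2) c keeps all denominators
    positive.\<close>
  proof (cases "s = 1")
    case True
    then show ?thesis using \<open>x \<in> fst ` S_OGF G\<close> by simp
  next
    case False
    have "0 < s\<^sup>2 * pn $ i + (1 - s\<^sup>2) * c" for i
    proof -
      have "0 \<le> pn $ i"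
        using S assms(1) by (auto simp: S_OGF_def valid_network_def intro: order_trans)
      moreover have "s\<^sup>2 < 1"
        using s False by (simp add: power_less_one_iff abs_square_less_1)
      ultimately show ?thesis
        using \<open>0 < c\<close> by (simp add: add_nonneg_pos)
    qed
    then have "scaled_state c s (x, pn, pp, \<phi>, \<alpha>) \<in> S_OGF G"
      using scaled_state_feasible[OF assms S] s by simp
    then show ?thesis
      by (force simp: image_iff)
  qed
qed

section \<open>Differentiability at the end of the path and the sign of the multiplier term\<close>

lemma differentiable_vec_lambda:
  fixes f :: "'a::real_normed_vector \<Rightarrow> 'n::finite \<Rightarrow> 'b::euclidean_space"
  assumes "\<And>i. (\<lambda>s. f s i) differentiable (at a within T)"
  shows "(\<lambda>s. \<chi> i. f s i) differentiable (at a within T)"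
proof -
  have "(\<lambda>s. (\<chi> i. f s i) \<bullet> axis k b) differentiable (at a within T)" for k b
    using assms[of k] by (auto simp: inner_axis differentiable_def intro: has_derivative_inner_left)
  then show ?thesis
    by (subst differentiable_componentwise_within) (auto simp: Basis_vec_def)
qed

text \<open>At s = 1 the denominator of each \<open>mixed_ratio\<close> entry is
  \<open>pn $ i\<close>; all other entries are polynomials in s.\<close>

lemma scaled_state_differentiable:
  assumes "\<forall>i. pn $ i \<noteq> 0"
  shows "(\<lambda>s. scaled_state c s (x, pn, pp, \<phi>, \<alpha>)) differentiable (at 1)"
  unfolding scaled_state.simps mixed_ratio_def
  using assms by (intro differentiable_Pair differentiable_vec_lambda derivative_intros) auto

lemma scaled_state_one:
  assumes "\<forall>i. pn $ i \<noteq> 0"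
  shows "scaled_state c 1 (x, pn, pp, \<phi>, \<alpha>) = (x, pn, pp, \<phi>, \<alpha>)"
  using assms by (simp add: mixed_ratio_def vec_eq_iff)

text \<open>Dividing by s - 1 < 0 reverses the inequality, so \<open>m\<close> bounds the left
  difference quotients from below, and these tend to 0.\<close>

lemma stationary_left_bound_nonpos:
  fixes f :: "real \<Rightarrow> real"
  assumes f: "(f has_real_derivative 0) (at 1)"
    and le: "\<And>s. 0 < s \<Longrightarrow> s < 1 \<Longrightarrow> f s - f 1 \<le> (s - 1) * m"
  shows "m \<le> 0"
proof -
  have "((\<lambda>s. (f s - f 1) / (s - 1)) \<longlongrightarrow> 0) (at_left 1)"
    using f has_field_derivative_at_within has_field_derivative_iff by blast
  moreover have "eventually (\<lambda>s. m \<le> (f s - f 1) / (s - 1)) (at_left 1)"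
    using eventually_at_left_real[of 0 "1::real"]
    by (rule eventually_mono) (use le in \<open>auto simp: neg_le_divide_eq mult.commute\<close>)
  ultimately show ?thesis
    by (rule tendsto_lowerbound) simp
qed

text \<open>Positive lower bounds on nodal pressures make the path differentiable at s = 1. Monotone
  prices ensure that moving the ratios toward 1 does not raise the cost.\<close>

lemma revenue_adequate_if_monotone_price:
  assumes valid: "valid_network G" and c: "0 < c"
    and node: "\<forall>i. node_lo G $ i \<le> c \<and> c \<le> node_hi G $ i"
    and pipe: "\<forall>(i, j) \<in> pipes G. pipe_lo G i j \<le> c \<and> c \<le> pipe_hi G i j"
    and lo: "\<forall>i. 0 < node_lo G $ i"
    and mono: "\<forall>(i, j) \<in> compressors G. mono_on {1..ratio_hi G i j} (comp_price G i j)"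
    and feas: "z \<in> feasible_set G"
  shows "revenue_adequate G z"
  unfolding revenue_adequate_def
proof (intro allI impI)
  fix \<mu>l \<mu>u lam \<nu>i \<nu>e
  assume kkt: "kkt_multipliers G z \<mu>l \<mu>u lam \<nu>i \<nu>e"
  obtain q x pn pp \<phi> \<alpha> where z: "z = (q, x, pn, pp, \<phi>, \<alpha>)"
    by (metis surj_pair)
  let ?y = "(x, pn, pp, \<phi>, \<alpha>)"
  let ?P = "\<lambda>s. scaled_state c s ?y"
  let ?L = "lagrangian G \<mu>l \<mu>u lam \<nu>i \<nu>e"
  have S: "?y \<in> S_OGF G" and M: "(q, x) \<in> M_OGF G"
    using feas by (auto simp: z feasible_set_def)
  have pn: "0 < pn $ i" for i
    using S lo by (auto simp: S_OGF_def intro: less_le_trans)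
  have P1: "?P 1 = ?y"
    by (rule scaled_state_one) (simp add: pn less_imp_neq[symmetric])
  have pos: "0 < s\<^sup>2 * pn $ i + (1 - s\<^sup>2) * c" if "0 < s" "s < 1" for s i
    using that pn c by (intro add_pos_pos) (simp_all add: abs_square_less_1)
  have PS: "?P s \<in> S_OGF G" if "0 < s" "s < 1" for s
    using scaled_state_feasible[OF valid c node pipe S] pos that by simp
  have eq0: "(\<Sum>k\<in>eq_constrs G. \<nu>e k * eq_fun G k w) = 0" if "w \<in> S_OGF G" for w
    using that S_OGF_iff_constraints[OF valid] by (simp add: sum.neutral)
  have nu: "\<And>k. k \<in> ineq_constrs G \<Longrightarrow> 0 \<le> \<nu>i k"
    and compl: "(\<Sum>k\<in>ineq_constrs G. \<nu>i k * ineq_fun G k ?y) = 0"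
    and stat: "GDERIV ?L (q, ?y) :> 0"
    using kkt unfolding kkt_multipliers_def z prod.case by (blast intro: sum.neutral)+
  have ineq: "(\<Sum>k\<in>ineq_constrs G. \<nu>i k * ineq_fun G k w) \<le> 0" if "w \<in> S_OGF G" for w
    using that S_OGF_iff_constraints[OF valid] nu by (intro sum_nonpos) (simp add: mult_nonneg_nonpos)
  have cost: "objective G (q, ?P s) \<le> objective G (q, ?y)" if s: "0 < s" "s < 1" for s
  proof -
    let ?a = "\<chi> i j. mixed_ratio c s (pn $ i) (\<alpha> $ i $ j)"
    have "comp_price G i j (ratio G ?a i j) \<le> comp_price G i j (ratio G \<alpha> i j)"
      if "(i, j) \<in> pipes G" for i j
    proof (cases "(i, j) \<in> compressors G")
      case True
      have a: "1 \<le> \<alpha> $ i $ j" "\<alpha> $ i $ j \<le> ratio_hi G i j"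
        using S that True by (auto simp: S_OGF_def ratio_def split: if_splits)
      have "1 \<le> mixed_ratio c s (pn $ i) (\<alpha> $ i $ j)" "mixed_ratio c s (pn $ i) (\<alpha> $ i $ j) \<le> \<alpha> $ i $ j"
        using mixed_ratio_bounds[OF _ c _ _ a(1) pos[OF s]] pn[of i] s by simp_all
      then show ?thesis
        using mono True a by (auto simp: ratio_def mono_on_def)
    qed (simp add: ratio_def)
    then show ?thesis
      by (auto simp: objective_def intro!: sum_mono)
  qed
  \<comment> \<open>With \<open>q\<close> held fixed, the path violates x = q - d unless x = 0; the
    multiplier term of this constraint contributes exactly (s - 1) times
    \<open>lam \<bullet> x\<close>, and the terms in \<open>\<mu>l\<close> and \<open>\<mu>u\<close>
    cancel.\<close>
  have incr: "?L (q, ?P s) - ?L (q, ?P 1) \<le> (s - 1) * (lam \<bullet> x)" if "0 < s" "s < 1" for s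
  proof -
    obtain y where y: "?P s = (s *\<^sub>R x, y)"
      by simp
    show ?thesis
      using cost[OF that] eq0[OF PS[OF that]] eq0[OF S] ineq[OF PS[OF that]] compl
      unfolding P1 y
      by (simp add: lagrangian_def inner_add_right inner_diff_right algebra_simps)
  qed
  have "((\<lambda>s. ?L (q, ?P s)) has_real_derivative 0) (at 1)"
  proof -
    have "?P differentiable (at 1)"
      by (rule scaled_state_differentiable) (simp add: pn less_imp_neq[symmetric])
    then obtain D where "(?P has_derivative D) (at 1)"
      by (auto simp: differentiable_def)
    then have "((\<lambda>s. (q, ?P s)) has_derivative (\<lambda>h. (0, D h))) (at 1)"
      by (intro derivative_intros)
    moreover have "(?L has_derivative (\<lambda>h. 0)) (at (q, ?P 1))"
      using stat unfolding P1 gderiv_def by simp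
    ultimately have "((\<lambda>s. ?L (q, ?P s)) has_derivative (\<lambda>h. 0)) (at 1)"
      by (rule has_derivative_compose)
    then show ?thesis
      by (rule has_derivative_imp_has_field_derivative) simp
  qed
  then have "lam \<bullet> x \<le> 0"
    using incr by (rule stationary_left_bound_nonpos)
  then show "0 \<le> net_revenue G lam z"
    using feas unfolding z by (simp add: net_revenue_eq)
qed

section \<open>Failure of the constraint qualification imposed on all inequalities\<close>

lemma gradient_affine: "gradient (\<lambda>w. w \<bullet> D + b) z = D"
proof -
  have D: "GDERIV (\<lambda>w. w \<bullet> D + b) z :> D"
    unfolding gderiv_def by (auto intro!: derivative_eq_intros)
  have "E = D" if "GDERIV (\<lambda>w. w \<bullet> D + b) z :> E" for E
  proof -
    have "(\<lambda>h. h \<bullet> E) = (\<lambda>h. h \<bullet> D)"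
      using that D unfolding gderiv_def by (rule has_derivative_unique)
    \<comment> \<open>Testing both derivatives in the direction E - D gives |E - D|^2 = 0.\<close>
    then have "(E - D) \<bullet> E = (E - D) \<bullet> D"
      by (rule fun_cong)
    then have "(E - D) \<bullet> (E - D) = 0"
      by (simp only: inner_diff_right diff_self)
    then show ?thesis
      by simp
  qed
  with D show ?thesis
    unfolding gradient_def by (rule the_equality)
qed

text \<open>No direction decreases both the upper and the lower bound constraint of one node, as
  their gradients are opposite. Hence the \<open>mfcq\<close> clause of the final result holds
  vacuously, and its revenue content lies in the \<open>mfcq_active\<close> clause.\<close>

lemma not_mfcq: "\<not> mfcq G z"
proof
  assume "mfcq G z"
  then obtain \<delta> where \<delta>: "\<And>k. k \<in> ineq_constrs G \<Longrightarrow> gradient (ineq_fun G k) (snd z) \<bullet> \<delta> < 0"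
    unfolding mfcq_def mfcq_wrt_def split_beta by blast
  fix i
  define D where "D = (0 :: real ^ 'a, axis i 1 :: real ^ 'a,
    0 :: real ^ 'a ^ 'a, 0 :: real ^ 'a ^ 'a, 0 :: real ^ 'a ^ 'a)"
  have "ineq_fun G (Node_Upper i) = (\<lambda>w. w \<bullet> D + (- (node_hi G $ i)))"
    and "ineq_fun G (Node_Lower i) = (\<lambda>w. w \<bullet> (- D) + node_lo G $ i)"
    by (auto simp: fun_eq_iff D_def inner_axis)
  then have "gradient (ineq_fun G (Node_Upper i)) (snd z) = D"
    and "gradient (ineq_fun G (Node_Lower i)) (snd z) = - D"
    by (simp_all only: gradient_affine)
  moreover have "Node_Upper i \<in> ineq_constrs G" "Node_Lower i \<in> ineq_constrs G"
    by (auto simp: ineq_constrs_def)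
  ultimately show False
    using \<delta>[of "Node_Upper i"] \<delta>[of "Node_Lower i"] by simp
qed

theorem theorem3:
  fixes G :: "('n::finite) gas_network" and \<pi>c :: real
  assumes "valid_network G"
    and "connected_network G"
    and "0 < \<pi>c"
    and "\<forall>i. node_lo G $ i \<le> \<pi>c \<and> \<pi>c \<le> node_hi G $ i"
    and "\<forall>(i, j) \<in> pipes G. pipe_lo G i j \<le> \<pi>c \<and> \<pi>c \<le> pipe_hi G i j"
  shows "globally_star_shaped (S_OGF G) \<and>
    (\<forall>z. locally_optimal G z \<and> mfcq G z \<longrightarrow> revenue_adequate G z) \<and>
    ((\<forall>i. 0 < node_lo G $ i) \<and>
     (\<forall>(i, j) \<in> compressors G. mono_on {1..ratio_hi G i j} (comp_price G i j)) \<longrightarrow>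
     (\<forall>z. locally_optimal G z \<and> mfcq_active G z \<longrightarrow> revenue_adequate G z))"
proof (intro conjI impI allI)
  show "globally_star_shaped (S_OGF G)"
    using assms by (intro globally_star_shaped_S_OGF)
next
  fix z
  assume "locally_optimal G z \<and> mfcq G z"
  then show "revenue_adequate G z"
    by (simp add: not_mfcq)
next
  fix z
  assume "(\<forall>i. 0 < node_lo G $ i) \<and>
      (\<forall>(i, j) \<in> compressors G. mono_on {1..ratio_hi G i j} (comp_price G i j))"
    and "locally_optimal G z \<and> mfcq_active G z"
  then show "revenue_adequate G z"
    using assms by (intro revenue_adequate_if_monotone_price) (auto simp: locally_optimal_def)
qed

end
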